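(* Let $0<\lambda_1<\lambda_2<\cdots<\lambda_n$ and $0<\mu_1<\mu_2<\cdots<\mu_n$ be positive real numbers. Then the $n\times n$ matrix $\left[\frac{1}{\beta(\lambda_i,\mu_j)}\right]_{i,j=1}^{n}$ is totally positive.
   Context: Here $\beta(x,y)=\frac{\Gamma(x)\Gamma(y)}{\Gamma(x+y)}$ is the beta function. A matrix is called totally positive if all its minors are (strictly) positive. *)

theory Defs
  imports
    "HOL-Analysis.Gamma_Function"
    "Jordan_Normal_Form.Determinant"
    "Jordan_Normal_Form.DL_Submatrix"
begin

(* A minor is given by a set I of row indices and a set J of column indices of the same
   size; submatrix keeps the selected rows and columns in increasing order. The empty
   minor is left out (its determinant is 1). *)
definition totally_positive :: "real mat \<Rightarrow> bool" where
  "totally_positive A \<longleftrightarrow>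
     (\<forall>I J. I \<subseteq> {..<dim_row A} \<longrightarrow> J \<subseteq> {..<dim_col A} \<longrightarrow> I \<noteq> {} \<longrightarrow> card I = card J \<longrightarrow>
        Determinant.det (submatrix A I J) > 0)"

end

theory Submission
  imports Defs
begin

text \<open>
  Since \<open>1 / Beta u v = Gamma (u + v) / (Gamma u * Gamma v)\<close>, the matrix is the kernel
  \<open>Gamma (u + v)\<close> on two sequences of nodes, with rows and columns multiplied by positive
  numbers. Its minors have the same form on subsequences of the nodes, so it is enough that
  \<open>det [Gamma (x i + y j)] > 0\<close> for all strictly increasing positive nodes.

  This determinant is not zero (\<open>det_Gamma_kernel_nonzero\<close>). A linear dependence of the columns
  is a function \<open>F x = (\<Sum>j. c j * Gamma (x + y j))\<close> with \<open>n\<close> zeros. By Euler's integral,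
  \<open>F x = \<integral>t>0. t powr x * P t * exp (-t) / t\<close> with
  \<open>P t = (\<Sum>j. c j * t powr y j)\<close>. As an exponential sum in \<open>ln t\<close>, \<open>P\<close> has fewer
  zeros, hence fewer sign changes, than terms (\<open>card_zeros_exp_sum\<close>). The transform has at most
  as many zeros as its density has sign changes (\<open>card_zeros_laplace\<close>), so \<open>F\<close> has fewer
  than \<open>n\<close> zeros. Both counts rest on Rolle's theorem.

  The sign follows by induction on \<open>n\<close> (\<open>det_kernel_pos\<close>): let the largest \<open>x\<close>-node
  tend to infinity. The determinant keeps its sign on the way, because it never vanishes, and in the
  end has the sign of its leading minor of size \<open>n - 1\<close>, because
  \<open>Gamma (x + a) / Gamma (x + b)\<close> tends to \<open>0\<close> for \<open>a < b\<close>.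
\<close>

section \<open>Zeros and signs of exponential sums\<close>

text \<open>
  Between consecutive zeros of \<open>f\<close> there is a zero of the derivative. The bound
  \<open>t < Max S\<close> is what the induction needs: the zero found next to a new maximum is then
  different from those already collected.
\<close>

lemma rolle_separated_zeros:
  fixes f f' :: "real \<Rightarrow> real"
  assumes I: "is_interval I"
    and deriv: "\<And>x. x \<in> I \<Longrightarrow> (f has_real_derivative f' x) (at x)"
    and S: "finite S" "S \<noteq> {}" "S \<subseteq> {x \<in> I. f x = 0}"
  shows "\<exists>T. finite T \<and> T \<subseteq> {x \<in> I. f' x = 0} \<and> card S = Suc (card T) \<and> (\<forall>t\<in>T. t < Max S)"
  using S
proof (induction S rule: finite_linorder_max_induct)
  case empty
  then show ?case by simp
next
  case (insert b S)
  show ?case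
  proof (cases "S = {}")
    case True
    then show ?thesis by (intro exI[of _ "{}"]) auto
  next
    case False
    define a where "a = Max S"
    have a: "a \<in> S" using False insert.hyps by (simp add: a_def)
    hence ab: "a < b" using insert.hyps by blast
    from insert False obtain T where T: "finite T" "T \<subseteq> {x \<in> I. f' x = 0}"
      "card S = Suc (card T)" "\<forall>t\<in>T. t < a" unfolding a_def by blast
    have mem: "x \<in> I" if "a \<le> x" "x \<le> b" for x
      using I a insert.prems that unfolding is_interval_1 by blast
    have "\<exists>z. a < z \<and> z < b \<and> f' z = 0"
    proof -
      have cont: "continuous_on {a..b} f"
        by (rule DERIV_continuous_on[of _ _ f']) (auto intro!: has_field_derivative_at_within deriv mem)
      have der: "\<And>x. \<lbrakk>a < x; x < b\<rbrakk> \<Longrightarrow> (f has_derivative (*) (f' x)) (at x)"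
        using deriv mem by (auto simp: has_field_derivative_def)
      have "f a = f b" using a insert.prems by auto
      from Rolle_deriv[OF ab this cont der]
      obtain z where z: "a < z" "z < b" "(*) (f' z) = (\<lambda>v. 0)" by blast
      from fun_cong[OF z(3), of 1] z(1,2) show ?thesis by auto
    qed
    then obtain z where z: "a < z" "z < b" "f' z = 0" by blast
    have "b \<notin> S" "z \<notin> T" using insert.hyps T z by fastforce+
    moreover have "Max (insert b S) = b"
      using insert.hyps by (intro Max_eqI) auto
    ultimately show ?thesis
      using T z mem[of z] ab insert.hyps(1) by (intro exI[of _ "insert z T"]) force
  qed
qed

lemma card_zeros_le_Suc_card_zeros_deriv:
  fixes f f' :: "real \<Rightarrow> real"
  assumes "is_interval I"
    and "\<And>x. x \<in> I \<Longrightarrow> (f has_real_derivative f' x) (at x)"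
    and bound: "\<And>T. \<lbrakk>finite T; T \<subseteq> {x \<in> I. f' x = 0}\<rbrakk> \<Longrightarrow> card T \<le> k"
    and S: "finite S" "S \<subseteq> {x \<in> I. f x = 0}"
  shows "card S \<le> Suc k"
  using rolle_separated_zeros[OF assms(1,2) S(1) _ S(2)] bound by (cases "S = {}") force+

text \<open>
  Divide by one of the exponentials, which changes no zero and turns its term into a constant. The
  derivative then has one term fewer, so Rolle's theorem allows at most one more zero per term.
\<close>

lemma card_zeros_exp_sum:
  fixes c y :: "'i \<Rightarrow> real"
  assumes "finite J" "J \<noteq> {}" "inj_on y J" "\<And>j. j \<in> J \<Longrightarrow> c j \<noteq> 0"
    and "finite T" "T \<subseteq> {s. (\<Sum>j\<in>J. c j * exp (y j * s)) = 0}"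
  shows "card T < card J"
  using assms
proof (induction J arbitrary: c y T rule: finite_ne_induct)
  case (singleton j)
  then have "T = {}" by auto
  then show ?case by simp
next
  case (insert k J)
  let ?g = "\<lambda>s. \<Sum>j\<in>insert k J. c j * exp ((y j - y k) * s)"
  let ?g' = "\<lambda>s. \<Sum>j\<in>insert k J. c j * (y j - y k) * exp ((y j - y k) * s)"
  have g: "(\<Sum>j\<in>insert k J. c j * exp (y j * s)) = exp (y k * s) * ?g s" for s
    by (simp add: sum_distrib_left algebra_simps flip: exp_add del: sum.insert)
  have g': "?g' s = (\<Sum>j\<in>J. c j * (y j - y k) * exp ((y j - y k) * s))" for s
    using insert.hyps by simp
  have nz: "c j * (y j - y k) \<noteq> 0" if "j \<in> J" for j
    using insert.prems(1,2) insert.hyps(3) that by (auto simp: inj_on_def)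
  have inj: "inj_on (\<lambda>j. y j - y k) J"
    using insert.prems(1) by (auto simp: inj_on_def)
  have "card T \<le> Suc (card J - 1)"
  proof (rule card_zeros_le_Suc_card_zeros_deriv[of UNIV ?g ?g'])
    show "(?g has_real_derivative ?g' s) (at s)" for s
      by (rule DERIV_sum) (auto intro!: derivative_eq_intros)
    show "card U \<le> card J - 1" if "finite U" "U \<subseteq> {s \<in> UNIV. ?g' s = 0}" for U
      using insert.IH[OF inj nz that(1)] that(2) unfolding g' by force
    show "T \<subseteq> {s \<in> UNIV. ?g s = 0}" using insert.prems(4) unfolding g by auto
  qed (use insert.prems in auto)
  moreover have "card J > 0" using insert.hyps by (simp add: card_gt_0_iff)
  ultimately show ?case using insert.hyps by simp
qed

text \<open>
  If \<open>f\<close> changes sign exactly at the points of \<open>A\<close>, then multiplying by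
  \<open>\<Prod>a\<in>A. s - a\<close> undoes all the changes. Such a set is found among the possible
  places \<open>Z\<close> of a sign change by removing the largest point \<open>z\<close> of \<open>Z\<close>: if
  \<open>f\<close> changes sign there, replace it by \<open>f s * (s - z)\<close>, which does not. The hypothesis
  leaves the values of \<open>f\<close> on \<open>Z\<close> free, unlike one on a continuous \<open>f\<close> with zero
  set \<open>Z\<close>; so the value at \<open>z\<close> can be overwritten, and \<open>z\<close> dropped from
  \<open>Z\<close>.
\<close>

lemma sign_pattern:
  fixes f :: "real \<Rightarrow> real"
  assumes "finite Z"
    and "\<And>u v. \<lbrakk>u \<le> v; {u..v} \<inter> Z = {}\<rbrakk> \<Longrightarrow> f u * f v > 0"
  shows "\<exists>A e. A \<subseteq> Z \<and> (\<forall>s. s \<notin> Z \<longrightarrow> e * (f s * (\<Prod>a\<in>A. s - a)) > 0)"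
  using assms
proof (induction Z arbitrary: f rule: finite_linorder_max_induct)
  case empty
  have "f 0 * f s > 0" for s
    using empty[of 0 s] empty[of s 0] by (cases "0 \<le> s") (auto simp: mult.commute)
  then show ?case by (intro exI[of _ "{}"] exI[of _ "f 0"]) auto
next
  case (insert z Z)
  have "\<exists>p<z. \<forall>u. p \<le> u \<and> u < z \<longrightarrow> u \<notin> Z"
  proof (cases "Z = {}")
    case True then show ?thesis by (intro exI[of _ "z - 1"]) auto
  next
    case False
    then have "Max Z < z" using insert.hyps by auto
    then show ?thesis using insert.hyps(1)
      by (intro exI[of _ "(Max Z + z) / 2"]) (auto dest!: Max_ge[rotated])
  qed
  then obtain p where p: "p < z" "\<And>u. \<lbrakk>p \<le> u; u < z\<rbrakk> \<Longrightarrow> u \<notin> Z" by blast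
  define q where "q = z + 1"
  \<comment> \<open>The signs at \<open>p\<close> and \<open>q\<close> are those immediately left and right of \<open>z\<close>.\<close>
  define same where "same \<longleftrightarrow> f p * f q > 0"
  define w where "w s = (if same then 1 else s - z)" for s
  define g where "g s = (if s = z then f q * w q else f s * w s)" for s
  have same_sign: "0 < a * c" if "0 < a * b" "0 < b * c" for a b c :: real
    using that by (auto simp: zero_less_mult_iff)
  have right: "f u * f v > 0" if "z < u" "u \<le> v" for u v
    using insert.prems[of u v] insert.hyps(2) that by fastforce
  have left: "f u * f v > 0" if "u \<le> v" "v < z" "{u..v} \<inter> Z = {}" for u v
    using insert.prems[of u v] that by auto
  have left_p: "f u * f p > 0" if "u < z" "{u..<z} \<inter> Z = {}" for u
  proof -
    have "{u..p} \<inter> Z = {}" "{p..u} \<inter> Z = {}" using that p by fastforce+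
    then show ?thesis
      using left[of u p] left[of p u] p(1) that(1) by (cases "u \<le> p") (auto simp: mult.commute)
  qed
  have right_q: "f v * f q > 0" if "z < v" for v
    using right[of v q] right[of q v] that by (cases "v \<le> q") (auto simp: q_def mult.commute)
  have "{p..<z} \<inter> Z = {}" using p(2) by auto
  then have nz: "f p \<noteq> 0" "f q \<noteq> 0" using left_p[of p] right_q[of q] p(1) by (auto simp: q_def)
  have w: "w s > 0" if "z < s" for s using that by (simp add: w_def)
  have "z < q" by (simp add: q_def)
  then have g_q: "g q = f q * w q" by (simp add: g_def)
  have g_right: "g u * g q > 0" if "z \<le> u" for u
  proof (cases "u = z")
    case True
    then have "g u * g q = (g q)\<^sup>2" by (simp add: g_def power2_eq_square q_def)
    then show ?thesis using nz(2) w[OF \<open>z < q\<close>] by (simp add: g_q)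
  next
    case False
    then have "g u * g q = (f u * f q) * (w u * w q)" by (simp add: g_q) (simp add: g_def)
    then show ?thesis using right_q[of u] w[of u] w[of q] \<open>z < q\<close> that False by simp
  qed
  have g_left: "g u * g q > 0" if u: "u < z" "{u..<z} \<inter> Z = {}" for u
  proof -
    have eq: "g u * g q = (f u * f q) * (w u * w q)" using u(1) by (simp add: g_q) (simp add: g_def)
    show ?thesis
    proof (cases same)
      case True
      then have "f u * f q > 0" using same_sign[OF left_p[OF u]] by (simp add: same_def)
      then show ?thesis unfolding eq using True by (simp add: w_def)
    next
      case False
      then have "f p * (- f q) > 0" using nz by (simp add: same_def not_less order_le_less)
      then have "f u * (- f q) > 0" using same_sign[OF left_p[OF u]] by blast
      moreover have "w u < 0" "w q > 0" using False u(1) \<open>z < q\<close> by (simp_all add: w_def)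
      ultimately show ?thesis unfolding eq by (simp add: mult_neg_neg mult_neg_pos)
    qed
  qed
  have g_sign: "g u * g v > 0" if uv: "u \<le> v" "{u..v} \<inter> Z = {}" for u v
  proof (cases "v < z")
    case True
    have "w u * w v > 0" using True uv(1) by (simp add: w_def mult_neg_neg)
    moreover have "g u * g v = (f u * f v) * (w u * w v)" using True uv(1) by (simp add: g_def)
    ultimately show ?thesis using left[OF uv(1) True uv(2)] by simp
  next
    case False
    have "{u..<z} \<subseteq> {u..v}" using False by auto
    then have "{u..<z} \<inter> Z = {}" using uv(2) by blast
    then have "g u * g q > 0" using g_left[of u] g_right[of u] by (cases "u < z") auto
    moreover have "g q * g v > 0" using g_right[of v] False by (simp add: mult.commute)
    ultimately show ?thesis by (rule same_sign)
  qed
  have "\<exists>A e. A \<subseteq> Z \<and> (\<forall>s. s \<notin> Z \<longrightarrow> e * (g s * (\<Prod>a\<in>A. s - a)) > 0)"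
    by (rule insert.IH) (rule g_sign)
  then obtain A e where Ae: "A \<subseteq> Z"
    "\<forall>s. s \<notin> Z \<longrightarrow> e * (g s * (\<Prod>a\<in>A. s - a)) > 0"
    by (elim exE conjE) (rule that)
  have fin: "finite A" "z \<notin> A" using Ae(1) insert.hyps finite_subset by blast+
  have "e * (f s * (\<Prod>a\<in>(if same then A else insert z A). s - a)) > 0" if "s \<notin> insert z Z" for s
    using Ae(2)[rule_format, of s] that fin by (auto simp: g_def w_def mult_ac)
  moreover have "(if same then A else insert z A) \<subseteq> insert z Z" using Ae(1) by auto
  ultimately show ?case by blast
qed

lemma exp_sum_sign_pattern:
  fixes c y :: "'i \<Rightarrow> real"
  assumes J: "finite J" "J \<noteq> {}" "inj_on y J" "\<And>j. j \<in> J \<Longrightarrow> c j \<noteq> 0"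
  obtains A Z e where "finite Z" "A \<subseteq> Z" "card Z < card J"
    "\<And>s. s \<notin> Z \<Longrightarrow> e * ((\<Sum>j\<in>J. c j * exp (y j * s)) * (\<Prod>a\<in>A. s - a)) > 0"
    "\<And>s. s \<in> Z \<Longrightarrow> (\<Sum>j\<in>J. c j * exp (y j * s)) = 0"
proof -
  let ?f = "\<lambda>s. \<Sum>j\<in>J. c j * exp (y j * s)"
  define Z where "Z = {s. ?f s = 0}"
  have bound: "card T < card J" if "finite T" "T \<subseteq> Z" for T
    using card_zeros_exp_sum[OF J that(1)] that(2) by (simp add: Z_def)
  have "finite Z"
  proof (rule ccontr)
    assume "infinite Z"
    then obtain T where "finite T" "card T = card J" "T \<subseteq> Z"
      using infinite_arbitrarily_large by blast
    then show False using bound[of T] by simp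
  qed
  moreover from this have "card Z < card J"
    using bound[of Z] by simp
  moreover have nz: "?f u * ?f v > 0" if "u \<le> v" "{u..v} \<inter> Z = {}" for u v
  proof (rule ccontr)
    assume neg: "\<not> ?f u * ?f v > 0"
    have cont: "continuous_on {u..v} ?f" by (intro continuous_intros)
    from neg consider "?f u \<le> 0" "0 \<le> ?f v" | "?f v \<le> 0" "0 \<le> ?f u"
      unfolding zero_less_mult_iff by linarith
    then have "\<exists>s. u \<le> s \<and> s \<le> v \<and> ?f s = 0"
      using IVT'[of ?f u 0 v] IVT2'[of ?f v 0 u] cont that(1) by cases blast+
    then show False using that(2) by (auto simp: Z_def)
  qed
  moreover obtain A e where "A \<subseteq> Z" "\<And>s. s \<notin> Z \<Longrightarrow> e * (?f s * (\<Prod>a\<in>A. s - a)) > 0"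
    using sign_pattern[OF \<open>finite Z\<close>, of ?f] nz by blast
  moreover have "?f s = 0" if "s \<in> Z" for s using that by (simp add: Z_def)
  ultimately show thesis using that[of Z A e] by blast
qed

section \<open>Zeros of Laplace transforms\<close>

lemma abs_exp_minus_one_le:
  fixes v :: real
  shows "\<bar>exp v - 1\<bar> \<le> \<bar>v\<bar> * exp \<bar>v\<bar>"
proof (cases "0 \<le> v")
  case True
  have "(1 - v) * exp v \<le> exp (-v) * exp v"
    using exp_ge_add_one_self[of "-v"] by (intro mult_right_mono) auto
  then show ?thesis using True by (simp add: algebra_simps flip: exp_add)
next
  case False
  have "- v * 1 \<le> - v * exp (- v)" using False by (intro mult_left_mono) auto
  moreover have "\<bar>exp v - 1\<bar> = 1 - exp v" "\<bar>v\<bar> = - v" using False by auto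
  moreover have "1 - exp v \<le> - v" using exp_ge_add_one_self[of v] by linarith
  ultimately show ?thesis by (simp only:)
qed

text \<open>
  The Laplace transform of \<open>h\<close> is taken in the exponent \<open>L\<close> and on a measure space of
  any kind, so that with \<open>L = ln\<close> the integral \<open>\<integral>t. t powr x * h t\<close> is an instance
  without a change of variables.
\<close>

definition laplace_integrable :: "'a measure \<Rightarrow> ('a \<Rightarrow> real) \<Rightarrow> ('a \<Rightarrow> real) \<Rightarrow> bool" where
  "laplace_integrable M L h \<longleftrightarrow> (\<forall>x>0. integrable M (\<lambda>w. exp (x * L w) * h w))"

text \<open>
  A linear factor \<open>\<bar>l\<bar>\<close> is dominated by \<open>exp (d * l) + exp (- d * l)\<close> up to a
  constant, and the transform still converges after a shift of \<open>x\<close> by \<open>\<plusminus>d\<close> because the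
  half line of convergence is open.
\<close>

lemma laplace_integrable_mult_exponent:
  assumes [measurable]: "L \<in> borel_measurable M" "h \<in> borel_measurable M"
    and h: "laplace_integrable M L h"
  shows "laplace_integrable M L (\<lambda>w. L w * h w)"
  unfolding laplace_integrable_def
proof (intro allI impI)
  fix x :: real assume x: "x > 0"
  define d where "d = x / 2"
  have d: "d > 0" "x + d > 0" "x - d > 0" using x by (auto simp: d_def)
  have key: "exp (x * l) * \<bar>l\<bar> \<le> (exp ((x + d) * l) + exp ((x - d) * l)) / d" for l
  proof -
    have "d * \<bar>l\<bar> \<le> exp (d * \<bar>l\<bar>)" using exp_ge_add_one_self[of "d * \<bar>l\<bar>"] by linarith
    also have "\<dots> \<le> exp (d * l) + exp (- d * l)" by (cases "0 \<le> l") auto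
    finally have "exp (x * l) * (d * \<bar>l\<bar>) \<le> exp (x * l) * (exp (d * l) + exp (- d * l))"
      by (intro mult_left_mono) auto
    then show ?thesis using d by (simp add: field_simps flip: exp_add)
  qed
  have "integrable M (\<lambda>w. (exp ((x + d) * L w) * h w + exp ((x - d) * L w) * h w) / d)"
    using h d unfolding laplace_integrable_def by auto
  then show "integrable M (\<lambda>w. exp (x * L w) * (L w * h w))"
  proof (rule Bochner_Integration.integrable_bound)
    have "norm (exp (x * l) * (l * u)) \<le> norm ((exp ((x + d) * l) * u + exp ((x - d) * l) * u) / d)"
      for l u
    proof -
      have "norm (exp (x * l) * (l * u)) = exp (x * l) * \<bar>l\<bar> * \<bar>u\<bar>" by (simp add: abs_mult)
      also have "\<dots> \<le> (exp ((x + d) * l) + exp ((x - d) * l)) / d * \<bar>u\<bar>"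
        by (intro mult_right_mono key) auto
      also have "\<dots> = \<bar>(exp ((x + d) * l) + exp ((x - d) * l)) / d * u\<bar>"
        using d by (simp add: abs_mult)
      finally show ?thesis by (simp add: algebra_simps)
    qed
    then show "AE w in M. norm (exp (x * L w) * (L w * h w))
        \<le> norm ((exp ((x + d) * L w) * h w + exp ((x - d) * L w) * h w) / d)" by simp
  qed simp
qed

text \<open>
  Differentiation under the integral sign, by dominated convergence. The difference quotients with
  step at most \<open>d = x / 2\<close> are dominated by the integrands at \<open>x + d\<close> and
  \<open>x - d\<close>, multiplied by \<open>\<bar>L\<bar>\<close>.
\<close>

lemma laplace_has_derivative:
  assumes [measurable]: "L \<in> borel_measurable M" "h \<in> borel_measurable M"
    and h: "laplace_integrable M L h" and x: "x > 0"
  shows "((\<lambda>x. \<integral>w. exp (x * L w) * h w \<partial>M) has_real_derivative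
          (\<integral>w. exp (x * L w) * (L w * h w) \<partial>M)) (at x)"
proof -
  let ?F = "\<lambda>x. \<integral>w. exp (x * L w) * h w \<partial>M"
  let ?D = "\<integral>w. exp (x * L w) * (L w * h w) \<partial>M"
  define d where "d = x / 2"
  have d: "d > 0" "x + d > 0" "x - d > 0" using x by (auto simp: d_def)
  note Lh = laplace_integrable_mult_exponent[OF assms(1-3)]
  let ?W = "\<lambda>w. exp ((x + d) * L w) * \<bar>L w * h w\<bar> + exp ((x - d) * L w) * \<bar>L w * h w\<bar>"
  have W: "integrable M ?W"
  proof (rule Bochner_Integration.integrable_add)
    have "integrable M (\<lambda>w. \<bar>exp (y * L w) * (L w * h w)\<bar>)" if "y > 0" for y
      using Lh that unfolding laplace_integrable_def by (intro integrable_abs) auto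
    then have "integrable M (\<lambda>w. exp (y * L w) * \<bar>L w * h w\<bar>)" if "y > 0" for y
      using that by (simp add: abs_mult)
    then show "integrable M (\<lambda>w. exp ((x + d) * L w) * \<bar>L w * h w\<bar>)"
      "integrable M (\<lambda>w. exp ((x - d) * L w) * \<bar>L w * h w\<bar>)" using d by auto
  qed
  have bound: "\<bar>(exp ((x + u) * l) * v - exp (x * l) * v) / u\<bar>
      \<le> exp ((x + d) * l) * \<bar>l * v\<bar> + exp ((x - d) * l) * \<bar>l * v\<bar>"
    if u: "u \<noteq> 0" "\<bar>u\<bar> \<le> d" for u l v
  proof -
    have "\<bar>(exp ((x + u) * l) * v - exp (x * l) * v) / u\<bar>
        = exp (x * l) * \<bar>v\<bar> / \<bar>u\<bar> * \<bar>exp (u * l) - 1\<bar>"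
    proof -
      have "(exp ((x + u) * l) * v - exp (x * l) * v) / u = exp (x * l) * v / u * (exp (u * l) - 1)"
        by (simp add: distrib_right exp_add diff_divide_distrib right_diff_distrib)
      then show ?thesis by (simp only: abs_mult abs_divide abs_exp_cancel)
    qed
    also have "\<dots> \<le> exp (x * l) * \<bar>v\<bar> / \<bar>u\<bar> * (\<bar>u * l\<bar> * exp \<bar>u * l\<bar>)"
      by (intro mult_left_mono abs_exp_minus_one_le) auto
    also have "\<dots> = exp (x * l) * \<bar>l * v\<bar> * exp \<bar>u * l\<bar>"
      using u by (simp add: abs_mult)
    also have "\<dots> \<le> exp (x * l) * \<bar>l * v\<bar> * exp (d * \<bar>l\<bar>)"
      using u by (intro mult_left_mono) (auto simp: abs_mult mult_right_mono)
    also have "\<dots> \<le> exp (x * l) * \<bar>l * v\<bar> * (exp (d * l) + exp (- d * l))"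
      by (intro mult_left_mono) (cases "0 \<le> l", auto)
    also have "\<dots> = exp ((x + d) * l) * \<bar>l * v\<bar> + exp ((x - d) * l) * \<bar>l * v\<bar>"
      by (simp add: algebra_simps flip: exp_add)
    finally show ?thesis .
  qed
  have "((\<lambda>u. (?F (x + u) - ?F x) / u) \<longlongrightarrow> ?D) (at 0)"
    unfolding tendsto_at_iff_sequentially
  proof (intro allI impI)
    fix X :: "nat \<Rightarrow> real"
    assume X: "\<forall>i. X i \<in> UNIV - {0}" "X \<longlonglongrightarrow> 0"
    from X(2) d(1) have "eventually (\<lambda>n. \<bar>X n\<bar> < d) sequentially"
      by (auto dest!: tendstoD simp: dist_norm)
    then obtain N where N: "\<And>n. \<bar>X (n + N)\<bar> < d"
      unfolding eventually_sequentially by (meson le_add2)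
    \<comment> \<open>A tail of the sequence, whose steps are all small enough for the bound.\<close>
    define Y where "Y n = X (n + N)" for n
    have Y: "Y n \<noteq> 0" "\<bar>Y n\<bar> < d" for n using X(1) N by (auto simp: Y_def)
    have Y0: "Y \<longlonglongrightarrow> 0" unfolding Y_def using X(2) by (rule LIMSEQ_ignore_initial_segment)
    have "(\<lambda>n. \<integral>w. (exp ((x + Y n) * L w) * h w - exp (x * L w) * h w) / Y n \<partial>M) \<longlonglongrightarrow> ?D"
    proof (rule integral_dominated_convergence[OF _ _ W])
      have "(\<lambda>n. (exp ((x + Y n) * l) * v - exp (x * l) * v) / Y n) \<longlonglongrightarrow> exp (x * l) * (l * v)" for l v
      proof -
        have "((\<lambda>x. exp (x * l) * v) has_real_derivative exp (x * l) * (l * v)) (at x)"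
          by (auto intro!: derivative_eq_intros)
        then show ?thesis
          using Y0 Y(1) unfolding DERIV_def tendsto_at_iff_sequentially
          by (auto simp: o_def)
      qed
      then show "AE w in M. (\<lambda>n. (exp ((x + Y n) * L w) * h w - exp (x * L w) * h w) / Y n)
          \<longlonglongrightarrow> exp (x * L w) * (L w * h w)" by simp
      show "AE w in M. norm ((exp ((x + Y n) * L w) * h w - exp (x * L w) * h w) / Y n) \<le> ?W w" for n
        unfolding real_norm_def by (intro AE_I2 bound Y less_imp_le)
    qed auto
    moreover have "(\<integral>w. (exp ((x + Y n) * L w) * h w - exp (x * L w) * h w) / Y n \<partial>M)
        = (?F (x + Y n) - ?F x) / Y n" for n
    proof -
      have "x + Y n > 0" using Y(2)[of n] d by linarith
      then show ?thesis using h x unfolding laplace_integrable_def by simp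
    qed
    ultimately have "(\<lambda>n. (?F (x + X (n + N)) - ?F x) / X (n + N)) \<longlonglongrightarrow> ?D"
      unfolding Y_def by (simp only:)
    then have "(\<lambda>n. (?F (x + X n) - ?F x) / X n) \<longlonglongrightarrow> ?D" by (rule LIMSEQ_offset)
    then show "((\<lambda>u. (?F (x + u) - ?F x) / u) \<circ> X) \<longlonglongrightarrow> ?D" by (simp add: o_def)
  qed
  then show ?thesis by (simp add: DERIV_def)
qed

text \<open>
  The transform has no more zeros than its density has sign changes: a continuous form of Descartes'
  rule of signs. If \<open>h\<close> changes sign at \<open>L = a\<close>, then \<open>exp (- a * x) * F x\<close> has the
  zeros of the transform \<open>F\<close>, and its derivative is \<open>exp (- a * x)\<close> times the transform of
  \<open>(L - a) * h\<close>, which has one sign change fewer. By Rolle's theorem each sign change accounts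
  for at most one zero. Without sign changes the integral is positive.
\<close>

lemma card_zeros_laplace:
  assumes [measurable]: "L \<in> borel_measurable M"
    and A: "finite A"
    and "h \<in> borel_measurable M" "laplace_integrable M L h"
    and "AE w in M. h w * (\<Prod>a\<in>A. L w - a) \<ge> 0"
    and "\<not> (AE w in M. h w * (\<Prod>a\<in>A. L w - a) = 0)"
    and "finite T" "T \<subseteq> {x \<in> {0<..}. (\<integral>w. exp (x * L w) * h w \<partial>M) = 0}"
  shows "card T \<le> card A"
  using A assms(3-)
proof (induction A arbitrary: h T rule: finite_induct)
  case empty
  have "(\<integral>w. exp (x * L w) * h w \<partial>M) \<noteq> 0" if "x > 0" for x
    using empty.prems that
    by (subst integral_nonneg_eq_0_iff_AE) (auto simp: laplace_integrable_def elim!: eventually_mono)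
  then have "T = {}" using empty.prems by auto
  then show ?case by simp
next
  case (insert a A)
  note [measurable] = insert.prems(1)
  define h1 where "h1 = (\<lambda>w. (L w - a) * h w)"
  let ?F = "\<lambda>x. \<integral>w. exp (x * L w) * h w \<partial>M"
  let ?G = "\<lambda>x. \<integral>w. exp (x * L w) * (L w * h w) \<partial>M"
  let ?F1 = "\<lambda>x. \<integral>w. exp (x * L w) * h1 w \<partial>M"
  have [measurable]: "h1 \<in> borel_measurable M" by (simp add: h1_def)
  have Lh: "laplace_integrable M L (\<lambda>w. L w * h w)"
    by (rule laplace_integrable_mult_exponent) (use insert.prems in auto)
  have split: "exp (x * L w) * h1 w = exp (x * L w) * (L w * h w) - a * (exp (x * L w) * h w)" for x w
    by (simp add: h1_def algebra_simps)
  have h1: "laplace_integrable M L h1"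
    using Lh insert.prems(2) unfolding laplace_integrable_def split by auto
  have F1: "?F1 x = ?G x - a * ?F x" if "x > 0" for x
    using Lh insert.prems(2) that unfolding laplace_integrable_def split by simp
  have prod: "h w * (\<Prod>a\<in>insert a A. L w - a) = h1 w * (\<Prod>a\<in>A. L w - a)" for w
    using insert.hyps by (simp add: h1_def mult_ac)
  have "card T \<le> Suc (card A)"
  proof (rule card_zeros_le_Suc_card_zeros_deriv
      [of "{0<..}" "\<lambda>x. exp (- a * x) * ?F x" "\<lambda>x. exp (- a * x) * ?F1 x"])
    show "((\<lambda>x. exp (- a * x) * ?F x) has_real_derivative exp (- a * x) * ?F1 x) (at x)"
      if "x \<in> {0<..}" for x
      
    proof -
      have "(?F has_real_derivative ?G x) (at x)"
        using laplace_has_derivative[OF assms(1) insert.prems(1,2), of x] that by simp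
      moreover have "((\<lambda>x. exp (- a * x)) has_real_derivative - a * exp (- a * x)) (at x)"
        by (auto intro!: derivative_eq_intros)
      ultimately have "((\<lambda>x. exp (- a * x) * ?F x) has_real_derivative
          exp (- a * x) * ?G x + - a * exp (- a * x) * ?F x) (at x)"
        by (rule DERIV_mult'[rotated])
      moreover have "exp (- a * x) * ?G x + - a * exp (- a * x) * ?F x = exp (- a * x) * ?F1 x"
      proof -
        have "e * g + - a * e * f = e * (g - a * f)" for e f g :: real
          by (simp add: algebra_simps)
        then show ?thesis unfolding F1[OF that[unfolded greaterThan_iff]] .
      qed
      ultimately show ?thesis by (simp only:)
    qed
    show "card U \<le> card A" if "finite U" "U \<subseteq> {x \<in> {0<..}. exp (- a * x) * ?F1 x = 0}" for U
      using that insert.prems(3,4) h1 unfolding prod by (intro insert.IH[of h1]) auto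
  qed (use insert.prems in \<open>auto simp: is_interval_1\<close>)
  then show ?case using insert.hyps by simp
qed

text \<open>
  The factor \<open>1 / t\<close> cancels the \<open>-1\<close> in the exponent of Euler's integral, so that
  \<open>\<integral>t. t powr x * gamma_weight t\<close> is \<open>Gamma x\<close> itself.
\<close>

definition gamma_weight :: "real \<Rightarrow> real" where
  "gamma_weight t = indicator {0<..} t * exp (-t) / t"

lemma Gamma_has_laplace_integral:
  assumes "x > 0"
  shows "has_bochner_integral lborel (\<lambda>t. exp (x * ln t) * gamma_weight t) (Gamma x)"
proof -
  have eq: "indicator {0..} t * t powr (x - 1) / exp t = exp (x * ln t) * gamma_weight t" for t :: real
  proof (cases "t > 0")
    case True
    then have "t powr (x - 1) = exp (x * ln t) / t"
      by (simp add: powr_def algebra_simps exp_diff)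
    then show ?thesis using True by (simp add: gamma_weight_def exp_minus field_simps)
  qed (auto simp: gamma_weight_def indicator_def)
  have "(\<integral>\<^sup>+t. ennreal (exp (x * ln t) * gamma_weight t) \<partial>lborel) = ennreal (Gamma x)"
    using Gamma_conv_nn_integral_real[OF assms] unfolding eq by simp
  then show ?thesis using assms
    by (intro has_bochner_integral_nn_integral)
      (auto simp: gamma_weight_def indicator_def less_imp_le)
qed

text \<open>
  The sum is the transform, in the exponent \<open>ln t\<close>, of
  \<open>(\<Sum>j\<in>J. c j * t powr y j) * gamma_weight t\<close>. The sum of powers is an exponential sum
  in \<open>ln t\<close>, so it has fewer than \<open>card J\<close> sign changes, and the weight is positive.
\<close>

lemma card_zeros_Gamma_sum:
  fixes c y :: "'i \<Rightarrow> real"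
  assumes J: "finite J" "J \<noteq> {}" "inj_on y J" "\<And>j. j \<in> J \<Longrightarrow> c j \<noteq> 0"
    and y: "\<And>j. j \<in> J \<Longrightarrow> y j > 0"
    and T: "finite T" "T \<subseteq> {x \<in> {0<..}. (\<Sum>j\<in>J. c j * Gamma (x + y j)) = 0}"
  shows "card T < card J"
proof -
  let ?P = "\<lambda>s. \<Sum>j\<in>J. c j * exp (y j * s)"
  obtain A Z e where Z: "finite Z" "A \<subseteq> Z" "card Z < card J"
    and pos: "\<And>s. s \<notin> Z \<Longrightarrow> e * (?P s * (\<Prod>a\<in>A. s - a)) > 0"
    and zero: "\<And>s. s \<in> Z \<Longrightarrow> ?P s = 0"
    by (rule exp_sum_sign_pattern[of J y c, OF J]) (assumption, rule that)
  \<comment> \<open>The sign \<open>e\<close> makes the density positive after the sign changes are removed.\<close>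
  define h where "h t = e * (?P (ln t) * gamma_weight t)" for t
  have [measurable]: "h \<in> borel_measurable lborel"
    unfolding h_def gamma_weight_def by measurable
  have bochner: "has_bochner_integral lborel (\<lambda>t. exp (x * ln t) * h t)
      (e * (\<Sum>j\<in>J. c j * Gamma (x + y j)))" if "x > 0" for x
  proof -
    have "has_bochner_integral lborel
        (\<lambda>t. e * (\<Sum>j\<in>J. c j * (exp ((x + y j) * ln t) * gamma_weight t)))
        (e * (\<Sum>j\<in>J. c j * Gamma (x + y j)))"
      using y that
      by (intro has_bochner_integral_mult_right has_bochner_integral_sum Gamma_has_laplace_integral)
        (auto intro: add_pos_pos)
    moreover have "e * (\<Sum>j\<in>J. c j * (exp ((x + y j) * ln t) * gamma_weight t)) = exp (x * ln t) * h t" for t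
    proof -
      have "exp ((x + y j) * ln t) = exp (x * ln t) * exp (y j * ln t)" for j
        by (simp add: distrib_right exp_add)
      then show ?thesis
        by (simp add: h_def sum_distrib_left sum_distrib_right mult_ac)
    qed
    ultimately show ?thesis by simp
  qed
  have h_pos: "h t * (\<Prod>a\<in>A. ln t - a) > 0" if "t > 0" "ln t \<notin> Z" for t
  proof -
    have "h t * (\<Prod>a\<in>A. ln t - a) = gamma_weight t * (e * (?P (ln t) * (\<Prod>a\<in>A. ln t - a)))"
      by (simp add: h_def mult_ac)
    moreover have "gamma_weight t > 0" using that by (simp add: gamma_weight_def)
    ultimately show ?thesis using pos[OF that(2)] by (simp only: mult_pos_pos)
  qed
  have "card T \<le> card A"
  proof (rule card_zeros_laplace[where L = ln and M = lborel and h = h])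
    show "finite A" using Z finite_subset by blast
    show "laplace_integrable lborel ln h"
      using bochner unfolding laplace_integrable_def by (auto dest: integrable.intros)
    have "h t * (\<Prod>a\<in>A. ln t - a) \<ge> 0" for t
      using h_pos[of t] zero[of "ln t"]
      by (cases "t > 0"; cases "ln t \<in> Z") (auto simp: h_def gamma_weight_def)
    then show "AE t in lborel. h t * (\<Prod>a\<in>A. ln t - a) \<ge> 0" by simp
    show "\<not> (AE t in lborel. h t * (\<Prod>a\<in>A. ln t - a) = 0)"
    proof
      assume ae: "AE t in lborel. h t * (\<Prod>a\<in>A. ln t - a) = 0"
      have "AE t in lborel. t \<notin> exp ` Z"
        using Z(1) by (intro AE_not_in countable_imp_null_set_lborel) (auto intro: countable_finite)
      with ae have "AE t in lborel. t \<notin> {0<..<1::real}"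
      proof eventually_elim
        case (elim t)
        show ?case
        proof
          assume "t \<in> {0<..<1}"
          then have t: "t > 0" by simp
          then have "ln t \<notin> Z" using elim(2) imageI[of "ln t" Z exp] unfolding exp_ln[OF t] by blast
          then show False using h_pos[OF t] elim(1) by linarith
        qed
      qed
      then have "emeasure lborel {0<..<1::real} = 0"
        by (subst (asm) AE_iff_measurable[of "{0<..<1}"]) auto
      then show False by simp
    qed
    show "T \<subseteq> {x \<in> {0<..}. (\<integral>t. exp (x * ln t) * h t \<partial>lborel) = 0}"
      using T by (auto simp: has_bochner_integral_integral_eq[OF bochner])
  qed (use T in auto)
  also have "\<dots> \<le> card Z" using Z by (simp add: card_mono)
  finally show ?thesis using Z by simp
qed

section \<open>From nonsingular to positive determinants\<close>

text \<open>
  By log-convexity the slope of \<open>ln \<circ> Gamma\<close> between \<open>x + a\<close> and \<open>x + b\<close> is at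
  least its slope between \<open>x + a - 1\<close> and \<open>x + a\<close>. By the functional equation the latter is
  \<open>ln (x + a - 1)\<close>, which is unbounded.
\<close>

lemma Gamma_shift_ratio_tendsto_0:
  fixes a b :: real
  assumes "a < b"
  shows "((\<lambda>x. Gamma (x + a) / Gamma (x + b)) \<longlongrightarrow> 0) at_top"
proof (rule tendsto_sandwich)
  have bound: "Gamma (x + a) / Gamma (x + b) \<le> (x + (a - 1)) powr (a - b)" if x: "x + a > 1" for x
  proof -
    have "Gamma (x + a) = (x + (a - 1)) * Gamma (x + (a - 1))"
      using Gamma_plus1[of "x + (a - 1)"] x by (simp add: nonpos_Ints_def algebra_simps)
    then have step: "ln (Gamma (x + a)) - ln (Gamma (x + (a - 1))) = ln (x + (a - 1))"
      using x Gamma_real_pos[of "x + (a - 1)"] by (simp add: ln_mult less_imp_neq[symmetric])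
    note cv = convex_on_slope_le[OF log_convex_Gamma_real, of "x + (a - 1)" "x + b" "x + a"]
    have "ln (x + (a - 1)) \<le> (ln (Gamma (x + a)) - ln (Gamma (x + b))) / (a - b)"
      using order.trans[OF cv] x assms step by simp
    then have "ln (Gamma (x + a)) - ln (Gamma (x + b)) \<le> (a - b) * ln (x + (a - 1))"
      using assms by (simp add: field_simps)
    then have "exp (ln (Gamma (x + a)) - ln (Gamma (x + b))) \<le> exp ((a - b) * ln (x + (a - 1)))"
      by simp
    then show ?thesis using x assms by (simp add: exp_diff powr_def)
  qed
  show "eventually (\<lambda>x. Gamma (x + a) / Gamma (x + b) \<le> (x + (a - 1)) powr (a - b)) at_top"
    using eventually_gt_at_top[of "1 - a"] by eventually_elim (use bound in auto)
  show "eventually (\<lambda>x. 0 \<le> Gamma (x + a) / Gamma (x + b)) at_top"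
    using eventually_gt_at_top[of "\<bar>a\<bar> + \<bar>b\<bar>"]
    by eventually_elim (auto intro!: divide_nonneg_nonneg less_imp_le[OF Gamma_real_pos])
  have "filterlim (\<lambda>x. x + (a - 1)) at_top at_top"
    by (subst add.commute, rule filterlim_tendsto_add_at_top[OF tendsto_const filterlim_ident])
  then show "((\<lambda>x. (x + (a - 1)) powr (a - b)) \<longlongrightarrow> 0) at_top"
    using assms by (intro tendsto_neg_powr) auto
qed simp

text \<open>
  Induction on \<open>n\<close>, moving the last node \<open>x n\<close> to infinity. On the way the nodes stay
  strictly increasing, so the determinant is never zero and keeps its sign. At infinity the last
  entry of the last row dominates that row, and in the expansion along the row its cofactor is the
  determinant of size \<open>n\<close>, which is positive by induction.
\<close>

lemma det_kernel_pos:
  fixes K :: "real \<Rightarrow> real \<Rightarrow> real" and x y :: "nat \<Rightarrow> real"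
  assumes cont: "\<And>v. v > 0 \<Longrightarrow> continuous_on {0<..} (\<lambda>u. K u v)"
    and dominated: "\<And>v w. \<lbrakk>0 < v; v < w\<rbrakk> \<Longrightarrow> ((\<lambda>u. K u v / K u w) \<longlongrightarrow> 0) at_top"
    and pos: "\<And>u v. \<lbrakk>0 < u; 0 < v\<rbrakk> \<Longrightarrow> K u v > 0"
    and nonsingular: "\<And>n x y. \<lbrakk>\<And>i. i < n \<Longrightarrow> 0 < x i; \<And>i. i < n \<Longrightarrow> 0 < y i;
        strict_mono_on {..<n} x; strict_mono_on {..<n} y\<rbrakk>
      \<Longrightarrow> Determinant.det (mat n n (\<lambda>(i, j). K (x i) (y j))) \<noteq> 0"
    and "\<And>i. i < n \<Longrightarrow> 0 < x i" "\<And>i. i < n \<Longrightarrow> 0 < y i"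
    and "strict_mono_on {..<n} x" "strict_mono_on {..<n} y"
  shows "Determinant.det (mat n n (\<lambda>(i, j). K (x i) (y j))) > 0"
  using assms(5-)
proof (induction n)
  case 0
  then show ?case by (simp add: Determinant.det_def)
next
  case (Suc n)
  define D where "D s = Determinant.det (mat (Suc n) (Suc n) (\<lambda>(i, j). K ((x(n := s)) i) (y j)))" for s
  \<comment> \<open>The cofactors along the last row; that row is deleted, so they do not depend on its node.\<close>
  define C where "C j = (-1) ^ (n + j) *
      Determinant.det (mat n n (\<lambda>(i, k). K (x i) (y (if k < j then k else Suc k))))" for j
  have "mat n n (\<lambda>(i, k). K (x i) (y (if k < n then k else Suc k))) = mat n n (\<lambda>(i, k). K (x i) (y k))"
    by (intro eq_matI) auto
  then have C: "C n > 0"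
    using Suc by (simp add: C_def strict_mono_on_def flip: mult_2)
  have D: "D s = (\<Sum>j<Suc n. K s (y j) * C j)" for s
  proof -
    let ?A = "mat (Suc n) (Suc n) (\<lambda>(i, j). K ((x(n := s)) i) (y j))"
    have "cofactor ?A n j = C j" if "j < Suc n" for j
      unfolding cofactor_def C_def mat_delete_def using that
      by (intro arg_cong[of _ _ "\<lambda>A. _ * Determinant.det A"] eq_matI) auto
    then show ?thesis
      unfolding D_def by (subst laplace_expansion_row[of ?A "Suc n" n]) (auto intro!: sum.cong)
  qed
  have nonzero: "D s \<noteq> 0" if "s \<ge> x n" for s
    unfolding D_def
  proof (rule nonsingular)
    show "0 < (x(n := s)) i" if "i < Suc n" for i
      using Suc.prems(1)[of i] Suc.prems(1)[of n] that \<open>s \<ge> x n\<close> by auto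
    show "strict_mono_on {..<Suc n} (x(n := s))"
      using Suc.prems(3) \<open>s \<ge> x n\<close> unfolding strict_mono_on_def
      by (auto simp: less_Suc_eq intro: less_le_trans)
  qed (use Suc.prems in auto)
  have yn: "y n > 0" "x n > 0" using Suc.prems by auto
  have "((\<lambda>s. (\<Sum>j<n. K s (y j) / K s (y n) * C j) + C n) \<longlongrightarrow> (\<Sum>j<n. 0 * C j) + C n) at_top"
    using Suc.prems(2,4)
    by (intro tendsto_intros dominated) (auto simp: strict_mono_on_def)
  then have "eventually (\<lambda>s. (\<Sum>j<n. K s (y j) / K s (y n) * C j) + C n > 0) at_top"
    using C by (intro order_tendstoD(1)) auto
  then have "eventually (\<lambda>s. D s > 0) at_top"
    using eventually_gt_at_top[of 0]
  proof eventually_elim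
    case (elim s)
    have K: "K s (y n) > 0" using pos elim yn by simp
    have "D s = K s (y n) * ((\<Sum>j<n. K s (y j) / K s (y n) * C j) + C n)"
      using K by (simp add: D distrib_left sum_distrib_left)
    then show ?case using K elim by simp
  qed
  then obtain s where s: "s \<ge> x n" "D s > 0"
    using eventually_ge_at_top[of "x n"] eventually_happens[OF eventually_conj]
      trivial_limit_at_top_linorder by (metis (mono_tags, lifting))
  have "continuous_on {x n..s} D"
    unfolding D using Suc.prems(2) yn
    by (intro continuous_intros continuous_on_subset[OF cont]) auto
  then have "D (x n) > 0"
    using IVT'[of D "x n" 0 s] nonzero s by (meson linorder_not_less less_imp_le)
  moreover have "x(n := x n) = x" by simp
  ultimately show ?case unfolding D_def by simp
qed

lemma det_scale_rows_cols:
  fixes K :: "nat \<Rightarrow> nat \<Rightarrow> 'a :: comm_ring_1"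
  shows "Determinant.det (mat n n (\<lambda>(i, j). r i * c j * K i j))
       = (\<Prod>i<n. r i) * (\<Prod>j<n. c j) * Determinant.det (mat n n (\<lambda>(i, j). K i j))"
proof -
  have "(\<Prod>i = 0..<n. mat n n (\<lambda>(i, j). r i * c j * K i j) $$ (i, p i))
      = (\<Prod>i<n. r i) * (\<Prod>j<n. c j) * (\<Prod>i = 0..<n. mat n n (\<lambda>(i, j). K i j) $$ (i, p i))"
    if p: "p permutes {0..<n}" for p
  proof -
    have "(\<Prod>i = 0..<n. c (p i)) = (\<Prod>i = 0..<n. c i)"
      using prod.permute[OF p, of c] by (simp add: o_def)
    moreover have "p i < n" if "i < n" for i
      using permutes_in_image[OF p, of i] that by simp
    ultimately show ?thesis by (simp add: prod.distrib lessThan_atLeast0)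
  qed
  then show ?thesis
    by (simp add: det_def'[of _ n] sum_distrib_left mult_ac)
qed

text \<open>
  A minor is the matrix of the same kernel on subsequences of the nodes, and these are again strictly
  increasing. Hence it suffices to know the sign of the full determinant for all nodes.
\<close>

lemma totally_positive_matI:
  fixes K :: "real \<Rightarrow> real \<Rightarrow> real" and x y :: "nat \<Rightarrow> real"
  assumes det: "\<And>k x y. \<lbrakk>\<And>i. i < k \<Longrightarrow> 0 < x i; \<And>i. i < k \<Longrightarrow> 0 < y i;
        strict_mono_on {..<k} x; strict_mono_on {..<k} y\<rbrakk>
      \<Longrightarrow> Determinant.det (mat k k (\<lambda>(i, j). K (x i) (y j))) > 0"
    and "\<And>i. i < n \<Longrightarrow> 0 < x i" "\<And>i. i < n \<Longrightarrow> 0 < y i"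
    and "strict_mono_on {..<n} x" "strict_mono_on {..<n} y"
  shows "totally_positive (mat n n (\<lambda>(i, j). K (x i) (y j)))"
  unfolding totally_positive_def
proof (intro allI impI)
  let ?A = "mat n n (\<lambda>(i, j). K (x i) (y j))"
  fix I J assume I: "I \<subseteq> {..<dim_row ?A}" and J: "J \<subseteq> {..<dim_col ?A}" and IJ: "card I = card J"
  have pick: "pick S i < n" if "S \<subseteq> {..<n}" "i < card S" for S i
    using pick_in_set_le[OF that(2)] that(1) by auto
  have pick_mono: "strict_mono_on {..<card S} (\<lambda>i. f (pick S i))"
    if "S \<subseteq> {..<n}" "strict_mono_on {..<n} f" for S and f :: "nat \<Rightarrow> real"
    using that(2) pick[OF that(1)] pick_mono_le unfolding strict_mono_on_def by auto
  have "{i. i < n \<and> i \<in> I} = I" "{j. j < n \<and> j \<in> J} = J" using I J by auto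
  then have "submatrix ?A I J = mat (card I) (card I) (\<lambda>(i, j). K (x (pick I i)) (y (pick J j)))"
    using pick I J IJ unfolding submatrix_def by (intro eq_matI) auto
  moreover have "Determinant.det \<dots> > 0"
    by (rule det) (use assms I J IJ pick pick_mono[of I x] pick_mono[of J y] in auto)
  ultimately show "Determinant.det (submatrix ?A I J) > 0" by simp
qed

section \<open>The Gamma and Beta kernels\<close>

text \<open>
  A nonzero null vector \<open>v\<close> of the matrix gives a function \<open>x \<mapsto> (\<Sum>j\<in>J. v $ j * Gamma (x + y j))\<close>
  with the \<open>n\<close> zeros \<open>x i\<close>, more than its at most \<open>n\<close> terms permit.
\<close>

lemma det_Gamma_kernel_nonzero:
  fixes x y :: "nat \<Rightarrow> real"
  assumes "\<And>i. i < n \<Longrightarrow> 0 < x i" "\<And>j. j < n \<Longrightarrow> 0 < y j"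
    and "inj_on x {..<n}" "inj_on y {..<n}"
  shows "Determinant.det (mat n n (\<lambda>(i, j). Gamma (x i + y j))) \<noteq> 0"
proof
  let ?A = "mat n n (\<lambda>(i, j). Gamma (x i + y j))"
  assume "Determinant.det ?A = 0"
  then obtain v where v: "v \<in> carrier_vec n" "v \<noteq> 0\<^sub>v n" "?A *\<^sub>v v = 0\<^sub>v n"
    using det_0_iff_vec_prod_zero[of ?A n] by auto
  define J where "J = {j. j < n \<and> v $ j \<noteq> 0}"
  have "J \<noteq> {}" using v(1,2) unfolding J_def by (auto simp: vec_eq_iff)
  have "(\<Sum>j\<in>J. v $ j * Gamma (x i + y j)) = 0" if "i < n" for i
  proof -
    have "(?A *\<^sub>v v) $ i = 0" using v(3) that by simp
    then have "(\<Sum>j\<in>{0..<n}. Gamma (x i + y j) * v $ j) = 0"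
      using that v(1) by (simp add: scalar_prod_def)
    moreover have "(\<Sum>j\<in>J. v $ j * Gamma (x i + y j)) = (\<Sum>j\<in>{0..<n}. Gamma (x i + y j) * v $ j)"
      by (rule sum.mono_neutral_cong_left) (auto simp: J_def)
    ultimately show ?thesis by simp
  qed
  then have "card (x ` {..<n}) < card J"
    using \<open>J \<noteq> {}\<close> assms
    by (intro card_zeros_Gamma_sum[where y = y and c = "\<lambda>j. v $ j"])
      (auto simp: J_def inj_on_def)
  moreover have "card J \<le> card {..<n}" by (rule card_mono) (auto simp: J_def)
  ultimately show False using assms(3) by (simp add: card_image)
qed

lemma det_Gamma_kernel_pos:
  fixes x y :: "nat \<Rightarrow> real"
  assumes "\<And>i. i < n \<Longrightarrow> 0 < x i" "\<And>j. j < n \<Longrightarrow> 0 < y j"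
    and "strict_mono_on {..<n} x" "strict_mono_on {..<n} y"
  shows "Determinant.det (mat n n (\<lambda>(i, j). Gamma (x i + y j))) > 0"
proof (rule det_kernel_pos[where K = "\<lambda>u v. Gamma (u + v)"])
  show "continuous_on {0<..} (\<lambda>u. Gamma (u + v))" if "v > 0" for v :: real
  proof -
    have "continuous_on {0<..} (Gamma :: real \<Rightarrow> real)"
      by (rule continuous_on_Gamma) (auto elim!: nonpos_Ints_cases')
    then show ?thesis
      by (rule continuous_on_compose2) (use that in \<open>auto intro!: continuous_intros\<close>)
  qed
  show "((\<lambda>u. Gamma (u + v) / Gamma (u + w)) \<longlongrightarrow> 0) at_top" if "v < w" for v w :: real
    using that by (rule Gamma_shift_ratio_tendsto_0)
  show "Determinant.det (mat n n (\<lambda>(i, j). Gamma (x i + y j))) \<noteq> 0"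
    if "\<And>i. i < n \<Longrightarrow> 0 < x i" "\<And>i. i < n \<Longrightarrow> 0 < y i"
      "strict_mono_on {..<n} x" "strict_mono_on {..<n} y" for n and x y :: "nat \<Rightarrow> real"
    by (rule det_Gamma_kernel_nonzero) (auto intro: that strict_mono_on_imp_inj_on)
qed (use assms in auto)

theorem corollary2p12:
  fixes n :: nat and l m :: "nat \<Rightarrow> real"
  assumes "\<And>i. i < n \<Longrightarrow> 0 < l i"
    and "\<And>i. i < n \<Longrightarrow> 0 < m i"
    and "strict_mono_on {..<n} l"
    and "strict_mono_on {..<n} m"
  shows "totally_positive (mat n n (\<lambda>(i, j). 1 / Beta (l i) (m j)))"
proof (rule totally_positive_matI[where K = "\<lambda>u v. 1 / Beta u v"])
  fix k :: nat and x y :: "nat \<Rightarrow> real"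
  assume xy: "\<And>i. i < k \<Longrightarrow> 0 < x i" "\<And>i. i < k \<Longrightarrow> 0 < y i"
    "strict_mono_on {..<k} x" "strict_mono_on {..<k} y"
  \<comment> \<open>The Gamma factors of one variable only rescale rows and columns.\<close>
  have "(\<lambda>(i, j). 1 / Beta (x i) (y j))
      = (\<lambda>(i, j). inverse (Gamma (x i)) * inverse (Gamma (y j)) * Gamma (x i + y j))"
    by (auto simp: Beta_def divide_simps)
  then have "Determinant.det (mat k k (\<lambda>(i, j). 1 / Beta (x i) (y j)))
      = (\<Prod>i<k. inverse (Gamma (x i))) * (\<Prod>j<k. inverse (Gamma (y j)))
        * Determinant.det (mat k k (\<lambda>(i, j). Gamma (x i + y j)))"
    by (simp add: det_scale_rows_cols)
  moreover have "(\<Prod>i<k. inverse (Gamma (x i))) > 0" "(\<Prod>j<k. inverse (Gamma (y j))) > 0"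
    using xy by (auto intro!: prod_pos)
  ultimately show "Determinant.det (mat k k (\<lambda>(i, j). 1 / Beta (x i) (y j))) > 0"
    using det_Gamma_kernel_pos[OF xy] by simp
qed (use assms in auto)

end
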